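(* The map $\mathrm{IG}:\{0,1\}^4\to\{0,1\}^4$, $(A,B,C,D)\mapsto(P,Q,R,S)$, given by the truth table in the context has the following properties. (i) It is reversible, i.e. a bijection of $\{0,1\}^4$. (ii) It is parity preserving: $A\oplus B\oplus C\oplus D=P\oplus Q\oplus R\oplus S$ for every input $(A,B,C,D)\in\{0,1\}^4$. (iii) It is universal: for every $n\ge 1$ and every Boolean function $f:\{0,1\}^n\to\{0,1\}$ there is a reversible circuit, all of whose gates are IG gates, with the variables $x_1,\dots,x_n$ and some constants from $\{0,1\}$ as inputs, such that one of the output lines carries $f(x_1,\dots,x_n)$ for every $(x_1,\dots,x_n)\in\{0,1\}^n$.
   Context: $\oplus$ denotes addition modulo 2 (EX-OR) on $\{0,1\}$. The 4*4 gate $\mathrm{IG}$ maps an input $(A,B,C,D)$ to an output $(P,Q,R,S)$ as follows (tuples written as bit strings $ABCD\mapsto PQRS$). If $A=0$: $0BCD\mapsto 0BCD$ for all $B,C,D\in\{0,1\}$. If $A=1$: $1000\mapsto1101$, $1001\mapsto1100$, $1010\mapsto1111$, $1011\mapsto1110$, $1100\mapsto1010$, $1101\mapsto1011$, $1110\mapsto1000$, $1111\mapsto1001$. A reversible circuit of IG gates on $k$ lines is a finite sequence of IG gates, each applied to an ordered 4-tuple of distinct lines among the $k$ lines, replacing the four values on those lines by the four output values of the gate. Thus the circuit is acyclic and there is no fan-out (each gate output and each input is used at most once). Each input line is either one of the input variables (each variable being placed on exactly one line) or is set to a constant in $\{0,1\}$ (a constant input, which does not depend on the values of the variables). Output lines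 that are not required may be ignored. *)

theory Defs
  imports "HOL-Library.Z2"
begin

text \<open>
  The set \<open>{0,1}\<close> is the type \<^typ>\<open>bit\<close>; its addition is addition modulo 2 (EX-OR).
\<close>

fun IG :: "bit \<times> bit \<times> bit \<times> bit \<Rightarrow> bit \<times> bit \<times> bit \<times> bit" where
  "IG (0, b, c, d) = (0, b, c, d)"
| "IG (1, 0, 0, 0) = (1, 1, 0, 1)"
| "IG (1, 0, 0, 1) = (1, 1, 0, 0)"
| "IG (1, 0, 1, 0) = (1, 1, 1, 1)"
| "IG (1, 0, 1, 1) = (1, 1, 1, 0)"
| "IG (1, 1, 0, 0) = (1, 0, 1, 0)"
| "IG (1, 1, 0, 1) = (1, 0, 1, 1)"
| "IG (1, 1, 1, 0) = (1, 0, 0, 0)"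
| "IG (1, 1, 1, 1) = (1, 0, 0, 1)"

text \<open>
  A circuit on \<open>k\<close> lines \<open>0, \<dots>, k - 1\<close> is the list of the ordered 4-tuples of
  lines to which its successive IG gates are applied; the values on the lines form a list of
  length \<open>k\<close>.
\<close>

type_synonym placement = "nat \<times> nat \<times> nat \<times> nat"

definition valid_circuit :: "nat \<Rightarrow> placement list \<Rightarrow> bool" where
  "valid_circuit k gs \<longleftrightarrow>
     (\<forall>(i, j, l, m) \<in> set gs. distinct [i, j, l, m] \<and> {i, j, l, m} \<subseteq> {..<k})"

fun apply_IG :: "placement \<Rightarrow> bit list \<Rightarrow> bit list" where
  "apply_IG (i, j, l, m) s =
     (case IG (s ! i, s ! j, s ! l, s ! m) of (p, q, r, t) \<Rightarrow> s[i := p, j := q, l := r, m := t])"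

definition run_circuit :: "placement list \<Rightarrow> bit list \<Rightarrow> bit list" where
  "run_circuit gs s = fold apply_IG gs s"

datatype input = Var nat | Const bit

text \<open>
  Variables are numbered from 0: \<open>Var i\<close> is the variable with value \<open>xs ! i\<close>.
  The input on line \<open>p\<close> is \<open>ins ! p\<close>.
\<close>

definition valid_inputs :: "nat \<Rightarrow> input list \<Rightarrow> bool" where
  "valid_inputs n ins \<longleftrightarrow>
     (\<forall>i. Var i \<in> set ins \<longrightarrow> i < n) \<and>
     (\<forall>i<n. \<exists>!p. p < length ins \<and> ins ! p = Var i)"

fun input_value :: "bit list \<Rightarrow> input \<Rightarrow> bit" where
  "input_value xs (Var i) = xs ! i"
| "input_value xs (Const c) = c"

end

theory Submission
  imports Defs
begin

text \<open>
  The gate is \<open>(A, B, C, D) \<mapsto> (A, A + B, C + A B, D + A (1 + B))\<close>. With all other inputs 0 it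
  copies \<open>A\<close> to \<open>Q\<close>, and with \<open>C = D = 0\<close> it yields \<open>A + B\<close> on \<open>Q\<close> and \<open>A B\<close> on \<open>R\<close>. Hence, with
  fresh constant lines, the sum and the product of the values of two lines can be computed while
  every existing line keeps its value. An arbitrary Boolean function is then obtained one variable
  at a time by the Shannon expansion \<open>f(x) = f(0) + x (f(0) + f(1))\<close>.
\<close>

section \<open>The gate as a polynomial map over the two-element field\<close>

lemma IG_formula: "IG (a, b, c, d) = (a, a + b, c + a * b, d + a * (1 + b))"
  by (cases a; cases b; cases c; cases d) simp_all

lemma bij_IG: "bij IG"
proof -
  \<comment> \<open>\<open>B\<close> is recovered as \<open>p + q\<close>; substituting it into the
    two products and adding them a second time cancels them, since \<open>x + x = 0\<close> for
    bits.\<close>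
  define inv where
    "inv = (\<lambda>(p, q, r, s). (p, p + q, r + p * (p + q), s + p * (1 + (p + q :: bit))))"
  have "inv (IG (a, b, c, d)) = (a, b, c, d)" for a b c d
    by (cases a; cases b; cases c; cases d) (simp_all add: inv_def)
  moreover have "IG (inv (a, b, c, d)) = (a, b, c, d)" for a b c d
    by (cases a; cases b; cases c; cases d) (simp_all add: inv_def)
  ultimately show ?thesis
    by (intro o_bij [of inv]) (auto simp: fun_eq_iff)
qed

lemma IG_parity_preserving:
  assumes "IG (A, B, C, D) = (P, Q, R, S)"
  shows "A + B + C + D = P + Q + R + S"
  using assms by (cases A; cases B; cases C; cases D) auto

section \<open>Circuits: concatenation, appended lines and the two-gate block\<close>

lemma length_apply_IG [simp]: "length (apply_IG g s) = length s"
  by (cases g) (simp add: IG_formula)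

lemma length_run_circuit [simp]: "length (run_circuit gs s) = length s"
  unfolding run_circuit_def by (induction gs arbitrary: s) simp_all

lemma run_circuit_append: "run_circuit (gs @ hs) s = run_circuit hs (run_circuit gs s)"
  by (simp add: run_circuit_def)

lemma valid_circuit_append:
  "valid_circuit k (gs @ hs) \<longleftrightarrow> valid_circuit k gs \<and> valid_circuit k hs"
  unfolding valid_circuit_def set_append ball_Un ..

lemma valid_circuit_mono:
  assumes "valid_circuit k gs" and "k \<le> k'"
  shows "valid_circuit k' gs"
  unfolding valid_circuit_def
proof
  fix g
  assume "g \<in> set gs"
  with assms(1) have "case g of (i, j, l, m) \<Rightarrow> distinct [i, j, l, m] \<and> {i, j, l, m} \<subseteq> {..<k}"
    unfolding valid_circuit_def by (rule bspec)
  with assms(2) show "case g of (i, j, l, m) \<Rightarrow> distinct [i, j, l, m] \<and> {i, j, l, m} \<subseteq> {..<k'}"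
    by (cases g) simp
qed

text \<open>Validity keeps every index below \<open>length s\<close>, so all reads and updates stay
  in the left part. Constant lines can therefore be appended late without changing what the earlier
  gates do.\<close>

lemma run_circuit_extra_lines:
  assumes "valid_circuit (length s) gs"
  shows "run_circuit gs (s @ t) = run_circuit gs s @ t"
  using assms
proof (induction gs arbitrary: s)
  case Nil
  then show ?case by (simp add: run_circuit_def)
next
  case (Cons g gs)
  obtain i j l m where g: "g = (i, j, l, m)" by (cases g)
  have "apply_IG g (s @ t) = apply_IG g s @ t"
    using Cons.prems
    by (simp add: g valid_circuit_def IG_formula nth_append list_update_append)
  moreover have "valid_circuit (length (apply_IG g s)) gs"
    using Cons.prems by (simp add: valid_circuit_def)
  ultimately show ?case
    using Cons.IH [of "apply_IG g s"] by (simp add: run_circuit_def)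
qed

text \<open>The first gate has zeros on its last three lines, so it copies \<open>s ! b\<close> to
  line \<open>k\<close> (and to line \<open>k + 2\<close>). The second gate takes this copy as
  \<open>B\<close>, with \<open>C = D = 0\<close>, which puts the sum on line \<open>k\<close> and
  the product on line \<open>k + 3\<close>. The lines \<open>a\<close> and \<open>b\<close> serve
  only as \<open>A\<close>, which the gate preserves.\<close>

lemma run_circuit_add_mult:
  fixes s :: "bit list"
  defines "k \<equiv> length s"
  assumes "a < k" and "b < k"
  shows "run_circuit [(b, k, k + 1, k + 2), (a, k, k + 3, k + 4)] (s @ [0, 0, 0, 0, 0]) =
    s @ [s ! a + s ! b, 0, s ! b, s ! a * s ! b, s ! a * (1 + s ! b)]"
proof -
  have "apply_IG (b, k, k + 1, k + 2) (s @ [0, 0, 0, 0, 0]) = s @ [s ! b, 0, s ! b, 0, 0]"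
    using assms by (simp add: IG_formula nth_append list_update_append numeral_eq_Suc)
  moreover have "apply_IG (a, k, k + 3, k + 4) (s @ [s ! b, 0, s ! b, 0, 0]) =
      s @ [s ! a + s ! b, 0, s ! b, s ! a * s ! b, s ! a * (1 + s ! b)]"
    using assms by (simp add: IG_formula nth_append list_update_append numeral_eq_Suc)
  ultimately show ?thesis
    by (simp add: run_circuit_def del: apply_IG.simps)
qed

lemma valid_inputs_append_Const:
  assumes "valid_inputs n ins"
  shows "valid_inputs n (ins @ map Const cs)"
proof -
  have "p < length (ins @ map Const cs) \<and> (ins @ map Const cs) ! p = Var i
      \<longleftrightarrow> p < length ins \<and> ins ! p = Var i" for p i
    by (auto simp: nth_append)
  with assms show ?thesis
    unfolding valid_inputs_def by auto
qed

section \<open>Functions carried jointly by one circuit, up to the Shannon expansion\<close>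

definition realized :: "nat \<Rightarrow> input list \<Rightarrow> placement list \<Rightarrow> (bit list \<Rightarrow> bit) \<Rightarrow> bool" where
  "realized n ins gs f \<longleftrightarrow>
     (\<exists>p<length ins. \<forall>xs. length xs = n \<longrightarrow> run_circuit gs (map (input_value xs) ins) ! p = f xs)"

text \<open>A whole set is tracked, not one function, because values computed earlier must still be
  available on some line of the same circuit when they are combined later.\<close>

definition jointly_computable :: "nat \<Rightarrow> (bit list \<Rightarrow> bit) set \<Rightarrow> bool" where
  "jointly_computable n F \<longleftrightarrow>
     (\<exists>ins gs. valid_inputs n ins \<and> valid_circuit (length ins) gs \<and> (\<forall>f\<in>F. realized n ins gs f))"

lemma jointly_computable_subset:
  "jointly_computable n F \<Longrightarrow> G \<subseteq> F \<Longrightarrow> jointly_computable n G"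
  unfolding jointly_computable_def by blast

text \<open>Only inputs of length \<open>n\<close> are ever tested. This allows identities such as
  the Shannon expansion, which is shown only for lists of that length.\<close>

lemma jointly_computable_cong:
  assumes "jointly_computable n (insert f F)" and "\<And>xs. length xs = n \<Longrightarrow> f xs = g xs"
  shows "jointly_computable n (insert g F)"
  using assms unfolding jointly_computable_def realized_def by simp

lemma jointly_computable_vars: "jointly_computable n ((\<lambda>i xs. xs ! i) ` {..<n})"
  unfolding jointly_computable_def
proof (intro exI conjI ballI)
  show "valid_inputs n (map Var [0..<n])"
    by (auto simp: valid_inputs_def)
  show "valid_circuit (length (map Var [0..<n])) []"
    by (simp add: valid_circuit_def)
  fix f :: "bit list \<Rightarrow> bit"
  assume "f \<in> (\<lambda>i xs. xs ! i) ` {..<n}"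
  then show "realized n (map Var [0..<n]) [] f"
    by (auto simp: realized_def run_circuit_def)
qed

lemma jointly_computable_const:
  assumes "jointly_computable n F"
  shows "jointly_computable n (insert (\<lambda>_. c) F)"
proof -
  obtain ins gs where valid: "valid_inputs n ins" "valid_circuit (length ins) gs"
    and F: "\<And>f. f \<in> F \<Longrightarrow> realized n ins gs f"
    using assms unfolding jointly_computable_def by blast
  let ?ins = "ins @ map Const [c]"
  have run: "run_circuit gs (map (input_value xs) ?ins)
      = run_circuit gs (map (input_value xs) ins) @ [c]" for xs
    using valid by (simp add: run_circuit_extra_lines)
  have "realized n ?ins gs (\<lambda>_. c)"
    unfolding realized_def run by (rule exI [of _ "length ins"]) (simp add: nth_append)
  moreover have "realized n ?ins gs f" if "f \<in> F" for f
    using F [OF that] unfolding realized_def run by (auto simp: nth_append intro: less_SucI)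
  moreover have "valid_circuit (length ?ins) gs"
    using valid(2) by (rule valid_circuit_mono) simp
  ultimately show ?thesis
    using valid_inputs_append_Const [OF valid(1), of "[c]"]
    unfolding jointly_computable_def by blast
qed

text \<open>Five zero lines and the two-gate block are appended to a circuit for \<open>F\<close>.
  All old lines keep their values, so \<open>F\<close> survives and the construction can be
  iterated.\<close>

lemma jointly_computable_add_mult:
  assumes "jointly_computable n F" and "f \<in> F" and "g \<in> F"
  shows "jointly_computable n (insert (\<lambda>xs. f xs + g xs) (insert (\<lambda>xs. f xs * g xs) F))"
proof -
  obtain ins gs where valid: "valid_inputs n ins" "valid_circuit (length ins) gs"
    and F: "\<And>f. f \<in> F \<Longrightarrow> realized n ins gs f"
    using assms(1) unfolding jointly_computable_def by blast
  obtain a where a: "a < length ins"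
    "\<And>xs. length xs = n \<Longrightarrow> run_circuit gs (map (input_value xs) ins) ! a = f xs"
    using F [OF assms(2)] unfolding realized_def by blast
  obtain b where b: "b < length ins"
    "\<And>xs. length xs = n \<Longrightarrow> run_circuit gs (map (input_value xs) ins) ! b = g xs"
    using F [OF assms(3)] unfolding realized_def by blast
  let ?k = "length ins"
  let ?ins = "ins @ map Const (replicate 5 0)"
  \<comment> \<open>Copying line \<open>b\<close> first also covers the case \<open>a = b\<close>, since a gate needs distinct lines.\<close>
  let ?hs = "[(b, ?k, ?k + 1, ?k + 2), (a, ?k, ?k + 3, ?k + 4)]"
  let ?gs = "gs @ ?hs"
  have circuit: "valid_circuit (length ?ins) ?gs"
    using valid_circuit_mono [OF valid(2), of "length ?ins"] a(1) b(1)
    by (simp add: valid_circuit_append) (simp add: valid_circuit_def)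
  have run: "run_circuit ?gs (map (input_value xs) ?ins) =
      run_circuit gs (map (input_value xs) ins) @
        [f xs + g xs, 0, g xs, f xs * g xs, f xs * (1 + g xs)]"
    if "length xs = n" for xs
  proof -
    let ?s = "run_circuit gs (map (input_value xs) ins)"
    have s: "length ?s = ?k" "?s ! a = f xs" "?s ! b = g xs"
      using a(2) b(2) that by simp_all
    have "run_circuit ?gs (map (input_value xs) ?ins) = run_circuit ?hs (?s @ [0, 0, 0, 0, 0])"
      using valid(2)
      by (simp add: run_circuit_append run_circuit_extra_lines numeral_eq_Suc)
    also have "\<dots> = ?s @ [f xs + g xs, 0, g xs, f xs * g xs, f xs * (1 + g xs)]"
      using run_circuit_add_mult [of a ?s b] a(1) b(1) s by simp
    finally show ?thesis .
  qed
  have "realized n ?ins ?gs (\<lambda>xs. f xs + g xs)"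
    unfolding realized_def using run
    by (intro exI [of _ ?k]) (simp add: nth_append)
  moreover have "realized n ?ins ?gs (\<lambda>xs. f xs * g xs)"
    unfolding realized_def using run
    by (intro exI [of _ "?k + 3"]) (simp add: nth_append)
  moreover have "realized n ?ins ?gs h" if h: "h \<in> F" for h
  proof -
    obtain p where "p < ?k"
      "\<And>xs. length xs = n \<Longrightarrow> run_circuit gs (map (input_value xs) ins) ! p = h xs"
      using F [OF h] unfolding realized_def by blast
    then show ?thesis
      unfolding realized_def using run by (intro exI [of _ p]) (simp add: nth_append)
  qed
  ultimately show ?thesis
    using valid_inputs_append_Const [OF valid(1), of "replicate 5 0"] circuit
    unfolding jointly_computable_def by blast
qed

text \<open>Induction on the number \<open>m\<close> of variables that matter. Fixing variable
  \<open>m\<close> to 0 or 1 leaves two functions of the first \<open>m\<close> variables, so the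
  induction hypothesis is needed for other functions than \<open>f\<close>.\<close>

lemma jointly_computable_prefix_function:
  assumes "m \<le> n" and "jointly_computable n F" and "(\<lambda>i xs. xs ! i) ` {..<n} \<subseteq> F"
  shows "jointly_computable n (insert (\<lambda>xs. f (take m xs)) F)"
  using assms
proof (induction m arbitrary: f F)
  case 0
  then show ?case by (simp add: jointly_computable_const)
next
  case (Suc m)
  let ?x = "\<lambda>xs. xs ! m :: bit"
  let ?f0 = "\<lambda>xs. f (take m xs @ [0])"
  let ?f1 = "\<lambda>xs. f (take m xs @ [1])"
  let ?d = "\<lambda>xs. ?f0 xs + ?f1 xs"
  let ?xd = "\<lambda>xs. ?x xs * ?d xs"
  have x: "?x \<in> F"
    using Suc.prems by auto
  have "jointly_computable n (insert ?f0 F)"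
    using Suc.IH [of F "\<lambda>ys. f (ys @ [0])"] Suc.prems by simp
  \<comment> \<open>The second cofactor is built on top of the circuit for the first one, which is
    why \<open>F\<close> is arbitrary in the induction.\<close>
  then have "jointly_computable n (insert ?f1 (insert ?f0 F))"
    using Suc.IH [of "insert ?f0 F" "\<lambda>ys. f (ys @ [1])"] Suc.prems by auto
  then have "jointly_computable n (insert ?d (insert ?f0 F))"
    by (rule jointly_computable_subset
        [OF jointly_computable_add_mult [where f = ?f0 and g = ?f1]]) auto
  then have "jointly_computable n (insert ?xd (insert ?f0 F))"
    by (rule jointly_computable_subset
        [OF jointly_computable_add_mult [where f = ?x and g = ?d]]) (use x in auto)
  then have "jointly_computable n (insert (\<lambda>xs. ?f0 xs + ?xd xs) F)"
    by (rule jointly_computable_subset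
        [OF jointly_computable_add_mult [where f = ?f0 and g = ?xd]]) auto
  then show ?case
  proof (rule jointly_computable_cong)
    fix xs :: "bit list"
    assume "length xs = n"
    then have take: "take (Suc m) xs = take m xs @ [xs ! m]"
      using Suc.prems(1) by (simp add: take_Suc_conv_app_nth)
    show "?f0 xs + ?xd xs = f (take (Suc m) xs)"
      unfolding take
      \<comment> \<open>At \<open>xs ! m = 0\<close> the product vanishes and \<open>?f0\<close>
        remains; at \<open>xs ! m = 1\<close> the two copies of \<open>?f0\<close> cancel and
        \<open>?f1\<close> remains.\<close>
      by (cases "xs ! m"; cases "?f0 xs"; cases "?f1 xs") simp_all
  qed
qed

text \<open>This is the case \<open>m = n\<close> of the prefix lemma, started from the circuit
  without gates that carries just the variables.\<close>

lemma jointly_computable_singleton: "jointly_computable n {f}"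
proof -
  let ?vars = "(\<lambda>i xs. xs ! i) ` {..<n} :: (bit list \<Rightarrow> bit) set"
  have "jointly_computable n (insert (\<lambda>xs. f (take n xs)) ?vars)"
    by (rule jointly_computable_prefix_function [OF order_refl jointly_computable_vars order_refl])
  then have "jointly_computable n (insert f ?vars)"
    by (rule jointly_computable_cong) simp
  then show ?thesis
    by (rule jointly_computable_subset) simp
qed

theorem mainTheorem1:
  shows "bij IG
    \<and> (\<forall>A B C D P Q R S. IG (A, B, C, D) = (P, Q, R, S) \<longrightarrow> A + B + C + D = P + Q + R + S)
    \<and> (\<forall>n\<ge>1. \<forall>f :: bit list \<Rightarrow> bit.
         \<exists>ins gs out. valid_inputs n ins \<and> valid_circuit (length ins) gs \<and> out < length ins \<and>
           (\<forall>xs. length xs = n \<longrightarrow>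
              run_circuit gs (map (input_value xs) ins) ! out = f xs))"
proof (intro conjI allI impI)
  show "bij IG"
    by (rule bij_IG)
next
  fix A B C D P Q R S
  assume "IG (A, B, C, D) = (P, Q, R, S)"
  then show "A + B + C + D = P + Q + R + S"
    by (rule IG_parity_preserving)
next
  fix n :: nat and f :: "bit list \<Rightarrow> bit"
  obtain ins gs where "valid_inputs n ins" "valid_circuit (length ins) gs" "realized n ins gs f"
    using jointly_computable_singleton [of n f] unfolding jointly_computable_def by auto
  then show "\<exists>ins gs out. valid_inputs n ins \<and> valid_circuit (length ins) gs \<and> out < length ins \<and>
      (\<forall>xs. length xs = n \<longrightarrow> run_circuit gs (map (input_value xs) ins) ! out = f xs)"
    unfolding realized_def by (elim exE conjE) (intro exI conjI)
qed

end
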